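(* Let $k$ be a domain, let $m\ge n\ge 1$, let $k[\mathbf{x}]=k[x_1,\ldots,x_n]$ and $k[\overline{\mathbf{x}}]=k[x_1,\ldots,x_m]$ be polynomial rings over $k$, and let $z$ be a further indeterminate. Let $\Gamma$ be a totally ordered additive group. Let $\phi:k[\mathbf{x}]\to k[\overline{\mathbf{x}}][z]$ be a homomorphism of $k$-algebras such that $\phi(k[\mathbf{x}])$ is not contained in $k[\overline{\mathbf{x}}]$, and put $p_i(z):=\phi(x_i)\in k[\overline{\mathbf{x}}][z]$ for $i=1,\ldots,n$. Let $\mathbf{w}=(w_1,\ldots,w_n)\in\Gamma^n$ be such that there exists $\mathbf{v}\in\Gamma^m$ for which $p_1(0)^{\mathbf{v}},\ldots,p_n(0)^{\mathbf{v}}$ are algebraically independent over $k$ and $\deg_{\mathbf{v}}p_i(0)=w_i$ for $i=1,\ldots,n$. Put $k[\mathbf{x}]^{\phi}:=\phi^{-1}(k[\overline{\mathbf{x}}])$. Let $S\subset k[\mathbf{x}]\setminus\{0\}$ be a subset such that $\operatorname{trans.deg}_k k[S]=n$. Then there exists $g\in S$ such that $g$ does not divide $f^{\mathbf{w}}$ (in $k[\mathbf{x}]$) for any $f\in k[\mathbf{x}]^{\phi}\setminus\{0\}$.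
   Context: "Domain" means commutative integral domain. A totally ordered additive group is an additive (abelian) group $\Gamma$ equipped with a total ordering such that $\alpha\le\beta$ implies $\alpha+\gamma\le\beta+\gamma$ for all $\alpha,\beta,\gamma\in\Gamma$. For a polynomial ring $k[x_1,\ldots,x_r]$ and $\mathbf{w}=(w_1,\ldots,w_r)\in\Gamma^r$, write $a\cdot\mathbf{w}=a_1w_1+\cdots+a_rw_r$ for $a=(a_1,\ldots,a_r)\in\mathbf{Z}^r$. For nonzero $f=\sum_a u_a x_1^{a_1}\cdots x_r^{a_r}$ with $u_a\in k$, put $\operatorname{supp}(f)=\{a\mid u_a\neq 0\}$; the $\mathbf{w}$-degree is $\deg_{\mathbf{w}}f=\max\{a\cdot\mathbf{w}\mid a\in\operatorname{supp}(f)\}$ and the $\mathbf{w}$-initial form $f^{\mathbf{w}}$ is the sum of the terms $u_ax_1^{a_1}\cdots x_r^{a_r}$ of $f$ with $a\in \operatorname{supp}(f)$ and $a\cdot\mathbf{w}=\deg_{\mathbf{w}}f$. For $f=0$, $\deg_{\mathbf{w}}f=-\infty$ and $f^{\mathbf{w}}=0$. $\operatorname{trans.deg}_k k[S]$ is the transcendence degree over $k$ of the $k$-subalgebra $k[S]$ of $k[\mathbf{x}]$ generated by $S$. *)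

theory Defs
  imports
    "HOL-Library.Cardinality"
    "HOL-Library.Poly_Mapping"
    "HOL-Library.Extended"
    "HOL-Library.Extended_Nat"
    "HOL-Computational_Algebra.Polynomial"
begin

text \<open>
  The polynomial ring over \<open>'k\<close> in variables indexed by \<open>'i\<close> is the monoid algebra of the monoid
  of exponent vectors \<open>'i \<Rightarrow>\<^sub>0 nat\<close>; its ring structure (hence also \<open>dvd\<close>) is that of
  \<^theory>\<open>HOL-Library.Poly_Mapping\<close>. The ring \<open>A[z]\<close> is \<open>A poly\<close>, with \<open>A\<close> sitting inside it as the
  polynomials \<open>[:c:]\<close>, and \<open>p(0)\<close> is \<open>poly p 0\<close>.
\<close>

type_synonym ('i, 'k) mpol = "('i \<Rightarrow>\<^sub>0 nat) \<Rightarrow>\<^sub>0 'k"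

definition Const :: "'k \<Rightarrow> ('i, 'k::comm_ring_1) mpol" where
  "Const c = Poly_Mapping.single 0 c"

definition Var :: "'i \<Rightarrow> ('i, 'k::comm_ring_1) mpol" where
  "Var i = Poly_Mapping.single (Poly_Mapping.single i 1) 1"

definition supp :: "('i, 'k::comm_ring_1) mpol \<Rightarrow> ('i \<Rightarrow>\<^sub>0 nat) set" where
  "supp f = Poly_Mapping.keys f"

definition vars :: "('i, 'k::comm_ring_1) mpol \<Rightarrow> 'i set" where
  "vars f = (\<Union>a\<in>supp f. Poly_Mapping.keys a)"

text \<open>\<open>subst_mpol p F\<close> is \<open>F\<close> with each variable \<open>i\<close> replaced by \<open>p i\<close>.\<close>

definition subst_mpol :: "('j \<Rightarrow> ('i, 'k) mpol) \<Rightarrow> ('j, 'k) mpol \<Rightarrow> ('i, 'k::comm_ring_1) mpol" where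
  "subst_mpol p F =
     (\<Sum>a\<in>supp F. Const (Poly_Mapping.lookup F a) *
        (\<Prod>j\<in>Poly_Mapping.keys a. p j ^ Poly_Mapping.lookup a j))"

text \<open>The inner sum is the multiple \<open>a\<^sub>i w\<^sub>i\<close> in the additive group \<open>'g\<close>.\<close>

definition wt :: "('i::finite \<Rightarrow> 'g::linordered_ab_group_add) \<Rightarrow> ('i \<Rightarrow>\<^sub>0 nat) \<Rightarrow> 'g" where
  "wt w a = (\<Sum>i\<in>UNIV. \<Sum>_<Poly_Mapping.lookup a i. w i)"

definition wdeg ::
  "('i::finite \<Rightarrow> 'g::linordered_ab_group_add) \<Rightarrow> ('i, 'k::comm_ring_1) mpol \<Rightarrow> 'g extended" where
  "wdeg w f = (if f = 0 then Minf else Fin (Max (wt w ` supp f)))"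

definition initial_form ::
  "('i::finite \<Rightarrow> 'g::linordered_ab_group_add) \<Rightarrow> ('i, 'k::comm_ring_1) mpol \<Rightarrow> ('i, 'k) mpol" where
  "initial_form w f =
     (\<Sum>a\<in>{a\<in>supp f. Fin (wt w a) = wdeg w f}. Poly_Mapping.single a (Poly_Mapping.lookup f a))"

definition alg_indep_on :: "'j set \<Rightarrow> ('j \<Rightarrow> ('i, 'k::comm_ring_1) mpol) \<Rightarrow> bool" where
  "alg_indep_on J p \<longleftrightarrow> (\<forall>F. vars F \<subseteq> J \<and> subst_mpol p F = 0 \<longrightarrow> F = 0)"

definition subalgebra :: "('i, 'k::comm_ring_1) mpol set \<Rightarrow> bool" where
  "subalgebra A \<longleftrightarrow>
     range Const \<subseteq> A \<and> (\<forall>f\<in>A. \<forall>g\<in>A. f + g \<in> A) \<and> (\<forall>f\<in>A. \<forall>g\<in>A. f * g \<in> A)"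

definition generated_subalgebra :: "('i, 'k::comm_ring_1) mpol set \<Rightarrow> ('i, 'k) mpol set" where
  "generated_subalgebra S = subalgebra hull S"

text \<open>
  The largest cardinality of an algebraically independent subset. In \<open>alg_indep_on B (\<lambda>b. b)\<close> the
  variables are indexed by the elements of \<open>B\<close>. Restricting to finite subsets loses nothing, as
  algebraic independence is inherited by subsets.
\<close>

definition trans_deg :: "('i, 'k::comm_ring_1) mpol set \<Rightarrow> enat" where
  "trans_deg A = (SUP B\<in>{B. B \<subseteq> A \<and> finite B \<and> alg_indep_on B (\<lambda>b. b)}. enat (card B))"

text \<open>Unitality follows from compatibility with the coefficients.\<close>

definition alg_hom :: "(('n, 'k::comm_ring_1) mpol \<Rightarrow> ('m, 'k) mpol poly) \<Rightarrow> bool" where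
  "alg_hom \<phi> \<longleftrightarrow>
     (\<forall>c. \<phi> (Const c) = [:Const c:]) \<and>
     (\<forall>f g. \<phi> (f + g) = \<phi> f + \<phi> g) \<and> (\<forall>f g. \<phi> (f * g) = \<phi> f * \<phi> g)"

definition z_free :: "'a::zero poly set" where
  "z_free = range (\<lambda>c. [:c:])"

end

theory Submission
  imports Defs "HOL-Library.FuncSet"
begin

text \<open>
  Write \<open>A\<close> for the polynomial ring in the \<open>m\<close> variables, so that \<open>p i = \<phi> (x\<^sub>i)\<close> lies in \<open>A[z]\<close>.
  Extend the weight \<open>v\<close> on \<open>A\<close> to \<open>A[z]\<close> by giving \<open>z\<close> the critical weight: the largest one for which
  the constant term of each \<open>p i\<close> still has maximal weight \<open>w i\<close> (lemma \<open>critical_weight\<close>). Let \<open>q i\<close>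
  be the part of \<open>p i\<close> of weight \<open>w i\<close>. Its constant term is the initial form of the constant term of
  \<open>p i\<close>, and because the weight is critical some \<open>q k\<close> really involves \<open>z\<close>.

  Let \<open>\<psi>\<close> be the homomorphism \<open>x\<^sub>i \<mapsto> q i\<close>. It is injective, since the constant terms of the \<open>q i\<close> are
  algebraically independent. For every nonzero \<open>f\<close> the part of \<open>\<phi> f\<close> of weight \<open>deg\<^sub>w f\<close> is
  \<open>\<psi> (f\<^sup>w)\<close> (lemma \<open>leading_part_eval\<close>). Hence if \<open>\<phi> f\<close> is free of \<open>z\<close>, then the nonzero element
  \<open>\<psi> (f\<^sup>w)\<close> is free of \<open>z\<close>, and so is \<open>\<psi> g\<close> for every divisor \<open>g\<close> of \<open>f\<^sup>w\<close> because \<open>A\<close> is a domain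
  (lemma \<open>z_free_factor\<close>).

  If every \<open>g\<close> in \<open>S\<close> were such a divisor, \<open>\<psi>\<close> would map \<open>k[S]\<close> into \<open>A\<close>. As \<open>k[S]\<close> has full
  transcendence degree, \<open>x\<^sub>k\<close> is algebraic over it (lemma \<open>algebraic_dependence\<close>, a count of
  monomials), so \<open>q k\<close> would be algebraic over \<open>A\<close>. But an element of \<open>A[z]\<close> of positive degree in \<open>z\<close>
  is transcendental over \<open>A\<close> (lemma \<open>z_free_coefficients_vanish\<close>).
\<close>

section \<open>Evaluation homomorphisms\<close>

locale unital_ring_hom =
  fixes h :: "'a::comm_ring_1 \<Rightarrow> 'b::comm_ring_1"
  assumes one: "h 1 = 1"
    and add: "h (x + y) = h x + h y"
    and mult: "h (x * y) = h x * h y"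
begin

lemma zero: "h 0 = 0"
  using add[of 0 0] by simp

lemma sum: "h (sum f A) = (\<Sum>i\<in>A. h (f i))"
  by (induction A rule: infinite_finite_induct) (simp_all add: zero add)

lemma prod: "h (prod f A) = (\<Prod>i\<in>A. h (f i))"
  by (induction A rule: infinite_finite_induct) (simp_all add: one mult)

lemma power: "h (x ^ n) = h x ^ n"
  by (induction n) (simp_all add: one mult)

end

lemma unital_ring_hom_Const: "unital_ring_hom Const"
  by unfold_locales (simp_all add: Const_def single_add mult_single)

lemma unital_ring_hom_constant_poly: "unital_ring_hom (\<lambda>c. [:c:])"
  by unfold_locales (simp_all add: one_pCons)

lemma unital_ring_hom_compose:
  "unital_ring_hom h \<Longrightarrow> unital_ring_hom h' \<Longrightarrow> unital_ring_hom (\<lambda>x. h (h' x))"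
  unfolding unital_ring_hom_def by simp

lemma unital_ring_hom_alg_hom: "alg_hom \<phi> \<Longrightarrow> unital_ring_hom \<phi>"
  unfolding alg_hom_def unital_ring_hom_def
  by (metis Const_def one_pCons single_one)

definition monomial_value :: "('j \<Rightarrow> 'r::comm_ring_1) \<Rightarrow> ('j \<Rightarrow>\<^sub>0 nat) \<Rightarrow> 'r" where
  "monomial_value p a = (\<Prod>j\<in>Poly_Mapping.keys a. p j ^ Poly_Mapping.lookup a j)"

lemma monomial_value_superset:
  assumes "finite K" "Poly_Mapping.keys a \<subseteq> K"
  shows "monomial_value p a = (\<Prod>j\<in>K. p j ^ Poly_Mapping.lookup a j)"
  unfolding monomial_value_def
  by (rule prod.mono_neutral_left) (use assms in \<open>auto simp: in_keys_iff\<close>)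

lemma monomial_value_zero [simp]: "monomial_value p 0 = 1"
  by (simp add: monomial_value_def)

lemma monomial_value_add: "monomial_value p (a + b) = monomial_value p a * monomial_value p b"
proof -
  define K where "K = Poly_Mapping.keys a \<union> Poly_Mapping.keys b"
  have "finite K" "Poly_Mapping.keys a \<subseteq> K" "Poly_Mapping.keys b \<subseteq> K"
    "Poly_Mapping.keys (a + b) \<subseteq> K"
    using keys_add[of a b] by (auto simp: K_def)
  then show ?thesis
    by (simp add: monomial_value_superset[of K] lookup_add power_add prod.distrib)
qed

text \<open>
  The coefficients are moved by \<open>h\<close> and the variables by \<open>p\<close>. Allowing any target ring lets
  one lemma, that this is a homomorphism, serve \<open>subst_mpol\<close>, the given \<open>\<phi>\<close> and the map
  \<open>\<psi>\<close> built from leading parts.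
\<close>

definition eval_mpol :: "('k::comm_ring_1 \<Rightarrow> 'r::comm_ring_1) \<Rightarrow> ('j \<Rightarrow> 'r) \<Rightarrow> ('j, 'k) mpol \<Rightarrow> 'r" where
  "eval_mpol h p F =
     (\<Sum>a\<in>Poly_Mapping.keys F. h (Poly_Mapping.lookup F a) * monomial_value p a)"

lemma subst_mpol_eq_eval: "subst_mpol p F = eval_mpol Const p F"
  by (simp add: subst_mpol_def eval_mpol_def monomial_value_def supp_def)

lemma mpol_eq_sum_singles:
  "F = (\<Sum>a\<in>Poly_Mapping.keys F. Poly_Mapping.single a (Poly_Mapping.lookup F a))"
  by (rule poly_mapping_eqI)
    (auto simp: lookup_sum lookup_single when_def sum.delta in_keys_iff)

context unital_ring_hom
begin

lemma eval_mpol_superset: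
  assumes "finite K" "Poly_Mapping.keys F \<subseteq> K"
  shows "eval_mpol h p F = (\<Sum>a\<in>K. h (Poly_Mapping.lookup F a) * monomial_value p a)"
  unfolding eval_mpol_def
  by (rule sum.mono_neutral_left) (use assms in \<open>auto simp: in_keys_iff zero\<close>)

lemma eval_mpol_single: "eval_mpol h p (Poly_Mapping.single a c) = h c * monomial_value p a"
  by (simp add: eval_mpol_def zero)

lemma eval_mpol_add: "eval_mpol h p (F + G) = eval_mpol h p F + eval_mpol h p G"
proof -
  define K where "K = Poly_Mapping.keys F \<union> Poly_Mapping.keys G"
  have "finite K" "Poly_Mapping.keys F \<subseteq> K" "Poly_Mapping.keys G \<subseteq> K"
    "Poly_Mapping.keys (F + G) \<subseteq> K"
    using keys_add[of F G] by (auto simp: K_def)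
  then show ?thesis
    by (simp add: eval_mpol_superset[of K] lookup_add add distrib_right sum.distrib)
qed

lemma eval_mpol_sum: "eval_mpol h p (sum F A) = (\<Sum>i\<in>A. eval_mpol h p (F i))"
  by (induction A rule: infinite_finite_induct) (simp_all add: eval_mpol_add, simp_all add: eval_mpol_def)

lemma eval_mpol_mult: "eval_mpol h p (F * G) = eval_mpol h p F * eval_mpol h p G"
proof -
  let ?s = "\<lambda>F a. Poly_Mapping.single a (Poly_Mapping.lookup F a)"
  have "F * G = (\<Sum>a\<in>Poly_Mapping.keys F. \<Sum>b\<in>Poly_Mapping.keys G. ?s F a * ?s G b)"
    by (subst (1 2) mpol_eq_sum_singles) (rule sum_product)
  then have "eval_mpol h p (F * G) =
      (\<Sum>a\<in>Poly_Mapping.keys F. \<Sum>b\<in>Poly_Mapping.keys G.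
        eval_mpol h p (?s F a) * eval_mpol h p (?s G b))"
    by (simp only: eval_mpol_sum mult_single eval_mpol_single mult monomial_value_add mult_ac)
  then show ?thesis
    by (simp only: eval_mpol_single eval_mpol_def[of h p F] eval_mpol_def[of h p G] sum_product)
qed

lemma unital_ring_hom_eval_mpol: "unital_ring_hom (eval_mpol h p)"
proof
  show "eval_mpol h p 1 = 1"
    using eval_mpol_single[of p 0 1] by (simp add: one)
qed (simp_all add: eval_mpol_add eval_mpol_mult)

lemma hom_monomial_value: "h (monomial_value p a) = monomial_value (\<lambda>j. h (p j)) a"
  by (simp add: monomial_value_def prod power)

lemma hom_eval_mpol: "h (eval_mpol h' p F) = eval_mpol (\<lambda>c. h (h' c)) (\<lambda>j. h (p j)) F"
  by (simp add: eval_mpol_def sum mult hom_monomial_value)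

end

lemma single_eq_monomial_value:
  "Poly_Mapping.single a c = Const c * monomial_value Var a"
proof -
  have pow: "Var j ^ n = Poly_Mapping.single (Poly_Mapping.single j n) 1" for j :: 'a and n
    by (induction n) (simp_all add: Var_def mult_single flip: single_add)
  have pr: "(\<Prod>j\<in>A. Poly_Mapping.single (f j) (1 :: 'b)) = Poly_Mapping.single (\<Sum>j\<in>A. f j) 1"
    for A :: "'a set" and f :: "'a \<Rightarrow> 'a \<Rightarrow>\<^sub>0 nat"
    by (induction A rule: infinite_finite_induct) (simp_all add: mult_single)
  show ?thesis
    by (simp add: monomial_value_def pow pr mult_single Const_def flip: mpol_eq_sum_singles)
qed

lemma mpol_eq_eval_Var: "F = eval_mpol Const Var F"
  by (subst mpol_eq_sum_singles) (simp add: eval_mpol_def single_eq_monomial_value)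

lemma alg_hom_eq_eval:
  assumes "alg_hom \<phi>"
  shows "\<phi> F = eval_mpol (\<lambda>c. [:Const c:]) (\<lambda>i. \<phi> (Var i)) F"
proof -
  interpret unital_ring_hom \<phi>
    using assms by (rule unital_ring_hom_alg_hom)
  have "\<phi> F = \<phi> (eval_mpol Const Var F)"
    by (simp flip: mpol_eq_eval_Var)
  then show ?thesis
    using assms by (simp add: hom_eval_mpol alg_hom_def)
qed

section \<open>The degree in \<open>z\<close>\<close>

text \<open>
  Refine \<open>A\<close> and \<open>B\<close> one coordinate at a time, keeping only the vectors that are maximal in that
  coordinate: a sum of two maximal entries is attained by maximal entries only. Once all
  coordinates are used, a single vector is left on each side. This picks the
  lexicographic maxima for some enumeration of the coordinates.
\<close>

lemma unique_sum_of_exponents: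
  fixes A B :: "('i::finite \<Rightarrow>\<^sub>0 nat) set"
  assumes "finite A" "A \<noteq> {}" "finite B" "B \<noteq> {}"
  shows "\<exists>a\<in>A. \<exists>b\<in>B. \<forall>a'\<in>A. \<forall>b'\<in>B. a' + b' = a + b \<longrightarrow> a' = a \<and> b' = b"
proof -
  let ?l = Poly_Mapping.lookup
  \<comment> \<open>\<open>A'\<close> and \<open>B'\<close> are the vectors still in the running after the coordinates in \<open>V\<close> are used.\<close>
  have refine: "\<exists>A' B'. A' \<subseteq> A \<and> A' \<noteq> {} \<and> B' \<subseteq> B \<and> B' \<noteq> {} \<and>
      (\<forall>a\<in>A'. \<forall>a'\<in>A'. \<forall>i\<in>V. ?l a i = ?l a' i) \<and> (\<forall>b\<in>B'. \<forall>b'\<in>B'. \<forall>i\<in>V. ?l b i = ?l b' i) \<and>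
      (\<forall>a\<in>A'. \<forall>b\<in>B'. \<forall>a'\<in>A. \<forall>b'\<in>B. a' + b' = a + b \<longrightarrow> a' \<in> A' \<and> b' \<in> B')" for V :: "'i set"
    using finite[of V]
  proof induction
    case empty
    show ?case
      by (intro exI[of _ A] exI[of _ B] conjI) (simp_all add: assms)
  next
    case (insert i V)
    obtain A' B' where A': "A' \<subseteq> A" "A' \<noteq> {}" and B': "B' \<subseteq> B" "B' \<noteq> {}"
      and eqA: "\<forall>a\<in>A'. \<forall>a'\<in>A'. \<forall>i\<in>V. ?l a i = ?l a' i"
      and eqB: "\<forall>b\<in>B'. \<forall>b'\<in>B'. \<forall>i\<in>V. ?l b i = ?l b' i"
      and closed: "\<forall>a\<in>A'. \<forall>b\<in>B'. \<forall>a'\<in>A. \<forall>b'\<in>B. a' + b' = a + b \<longrightarrow> a' \<in> A' \<and> b' \<in> B'"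
      using insert.IH by (elim exE conjE) (rule that)
    have fin: "finite A'" "finite B'"
      using A' B' assms finite_subset by auto
    define M where "M = Max ((\<lambda>a. ?l a i) ` A')"
    define N where "N = Max ((\<lambda>b. ?l b i) ` B')"
    have M: "?l a i \<le> M" if "a \<in> A'" for a
      using that fin by (simp add: M_def)
    have N: "?l b i \<le> N" if "b \<in> B'" for b
      using that fin by (simp add: N_def)
    have "M \<in> (\<lambda>a. ?l a i) ` A'" "N \<in> (\<lambda>b. ?l b i) ` B'"
      using A' B' fin by (simp_all add: M_def N_def)
    then have ne: "{a\<in>A'. ?l a i = M} \<noteq> {}" "{b\<in>B'. ?l b i = N} \<noteq> {}"
      by auto
    have "a' \<in> A' \<and> ?l a' i = M \<and> b' \<in> B' \<and> ?l b' i = N"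
      if "a \<in> A'" "?l a i = M" "b \<in> B'" "?l b i = N" "a' \<in> A" "b' \<in> B" "a' + b' = a + b"
      for a b a' b'
    proof -
      have *: "a' \<in> A'" "b' \<in> B'"
        using closed that by blast+
      have "?l a' i + ?l b' i = M + N"
        using that lookup_add[of a' b' i] lookup_add[of a b i] by simp
      with M[OF *(1)] N[OF *(2)] * show ?thesis
        by simp
    qed
    then have "\<forall>a\<in>{a\<in>A'. ?l a i = M}. \<forall>b\<in>{b\<in>B'. ?l b i = N}. \<forall>a'\<in>A. \<forall>b'\<in>B.
        a' + b' = a + b \<longrightarrow> a' \<in> {a\<in>A'. ?l a i = M} \<and> b' \<in> {b\<in>B'. ?l b i = N}"
      by blast
    moreover have "\<forall>a\<in>{a\<in>A'. ?l a i = M}. \<forall>a'\<in>{a\<in>A'. ?l a i = M}. \<forall>i\<in>insert i V. ?l a i = ?l a' i"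
      using eqA by simp
    moreover have "\<forall>b\<in>{b\<in>B'. ?l b i = N}. \<forall>b'\<in>{b\<in>B'. ?l b i = N}. \<forall>i\<in>insert i V. ?l b i = ?l b' i"
      using eqB by simp
    moreover have "{a\<in>A'. ?l a i = M} \<subseteq> A" "{b\<in>B'. ?l b i = N} \<subseteq> B"
      using A' B' by blast+
    ultimately show ?case
      using ne by (intro exI[of _ "{a\<in>A'. ?l a i = M}"] exI[of _ "{b\<in>B'. ?l b i = N}"] conjI)
  qed
  obtain A' B' where A': "A' \<subseteq> A" "A' \<noteq> {}" and B': "B' \<subseteq> B" "B' \<noteq> {}"
    and eqA: "\<forall>a\<in>A'. \<forall>a'\<in>A'. \<forall>i\<in>UNIV. ?l a i = ?l a' i"
    and eqB: "\<forall>b\<in>B'. \<forall>b'\<in>B'. \<forall>i\<in>UNIV. ?l b i = ?l b' i"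
    and closed: "\<forall>a\<in>A'. \<forall>b\<in>B'. \<forall>a'\<in>A. \<forall>b'\<in>B. a' + b' = a + b \<longrightarrow> a' \<in> A' \<and> b' \<in> B'"
    using refine[of UNIV] by (elim exE conjE) (rule that)
  obtain a b where ab: "a \<in> A'" "b \<in> B'"
    using A' B' by blast
  have uniq: "a' = a \<and> b' = b" if "a' \<in> A" "b' \<in> B" "a' + b' = a + b" for a' b'
  proof -
    have *: "a' \<in> A'" "b' \<in> B'"
      using closed[rule_format, OF ab that] by simp_all
    show ?thesis
      using eqA[rule_format, OF *(1) ab(1) UNIV_I] eqB[rule_format, OF *(2) ab(2) UNIV_I]
      by (intro conjI poly_mapping_eqI)
  qed
  show ?thesis
  proof (intro bexI ballI impI)
    show "a \<in> A" "b \<in> B"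
      using A' B' ab by auto
  qed (rule uniq)
qed

text \<open>
  The coefficient of \<open>f * g\<close> at a uniquely attained sum of exponents is a product of two nonzero
  coefficients.
\<close>

lemma mpol_no_zero_divisors:
  fixes f g :: "('i::finite, 'k::idom) mpol"
  assumes "f \<noteq> 0" "g \<noteq> 0"
  shows "f * g \<noteq> 0"
proof -
  let ?l = Poly_Mapping.lookup and ?k = Poly_Mapping.keys
  have "?k f \<noteq> {}" "?k g \<noteq> {}"
    using assms by simp_all
  then obtain a b where ab: "a \<in> ?k f" "b \<in> ?k g"
    and uniq: "\<And>a' b'. a' \<in> ?k f \<Longrightarrow> b' \<in> ?k g \<Longrightarrow> a' + b' = a + b \<Longrightarrow> a' = a \<and> b' = b"
    using unique_sum_of_exponents[of "?k f" "?k g"] by auto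
  have "?l f l * (\<Sum>q. ?l g q when a + b = l + q) = (?l f a * ?l g b when l = a)" for l
  proof (cases "l = a")
    case True
    then have "(\<lambda>q. ?l g q when a + b = l + q) = (\<lambda>q. ?l g q when q = b)"
      by (auto simp: when_def fun_eq_iff)
    then show ?thesis
      using True by simp
  next
    case False
    have "(?l g q when a + b = l + q) = 0" if "?l f l \<noteq> 0" for q
    proof -
      have "q \<notin> ?k g \<or> a + b \<noteq> l + q"
        using uniq[of l q] that False by (metis in_keys_iff)
      then show ?thesis
        by (auto simp: in_keys_iff)
    qed
    then show ?thesis
      using False by (cases "?l f l = 0") simp_all
  qed
  then have "?l (f * g) (a + b) = ?l f a * ?l g b"
    by (simp only: lookup_mult Sum_any_when_equal)
  then show ?thesis
    using ab by (auto simp: in_keys_iff)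
qed

lemma degree_mpol_poly_mult:
  fixes P Q :: "('i::finite, 'k::idom) mpol poly"
  assumes "P \<noteq> 0" "Q \<noteq> 0"
  shows "degree (P * Q) = degree P + degree Q"
    and "P * Q \<noteq> 0"
proof -
  have nz: "coeff (P * Q) (degree P + degree Q) \<noteq> 0"
    using assms by (simp add: coeff_mult_degree_sum mpol_no_zero_divisors)
  then show "degree (P * Q) = degree P + degree Q"
    by (intro order_antisym degree_mult_le le_degree)
  show "P * Q \<noteq> 0"
    using nz by auto
qed

lemma degree_mpol_poly_power:
  fixes Q :: "('i::finite, 'k::idom) mpol poly"
  assumes "Q \<noteq> 0"
  shows "degree (Q ^ j) = j * degree Q" and "Q ^ j \<noteq> 0"
  using assms by (induction j) (simp_all add: degree_mpol_poly_mult)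

lemma z_free_iff: "P \<in> z_free \<longleftrightarrow> degree P = 0"
  by (auto simp: z_free_def elim!: degree_eq_zeroE)

text \<open>
  This is factorial closedness of \<open>A\<close> in \<open>A[z]\<close>: degrees in \<open>z\<close> add up.
\<close>

lemma z_free_factor:
  fixes P Q :: "('i::finite, 'k::idom) mpol poly"
  assumes "P * Q \<in> z_free" "P * Q \<noteq> 0"
  shows "P \<in> z_free"
proof -
  have "P \<noteq> 0" "Q \<noteq> 0"
    using assms(2) by auto
  then show ?thesis
    using assms(1) by (simp add: z_free_iff degree_mpol_poly_mult)
qed

text \<open>
  An element of \<open>A[z]\<close> outside \<open>A\<close> is transcendental over \<open>A\<close>: its powers have pairwise distinct
  degrees in \<open>z\<close>, so the top degree of a relation comes from one summand only.
\<close>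

lemma z_free_coefficients_vanish:
  fixes Q :: "('i::finite, 'k::idom) mpol poly"
  assumes c: "\<And>j. j < N \<Longrightarrow> c j \<in> z_free" and Q: "Q \<notin> z_free"
    and zero: "(\<Sum>j<N. c j * Q ^ j) = 0" and "j < N"
  shows "c j = 0"
proof (rule ccontr)
  assume "c j \<noteq> 0"
  define J where "J = {j. j < N \<and> c j \<noteq> 0}"
  define m where "m = Max J"
  have "finite J" "J \<noteq> {}"
    using \<open>c j \<noteq> 0\<close> \<open>j < N\<close> by (auto simp: J_def)
  then have m: "m \<in> J" "\<And>i. i \<in> J \<Longrightarrow> i \<le> m"
    by (simp_all add: m_def)
  have "Q \<noteq> 0" "degree Q > 0"
    using Q by (auto simp: z_free_iff)
  have deg: "degree (c i * Q ^ i) = i * degree Q" if "i \<in> J" for i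
    using that c \<open>Q \<noteq> 0\<close> by (simp add: J_def degree_mpol_poly_mult degree_mpol_poly_power z_free_iff)
  have "coeff (c i * Q ^ i) (m * degree Q) = 0" if "i < N" "i \<noteq> m" for i
  proof (cases "i \<in> J")
    case True
    then have "i < m"
      using m(2)[of i] that by simp
    then show ?thesis
      using deg[OF True] \<open>degree Q > 0\<close> by (intro coeff_eq_0) simp
  qed (use that in \<open>simp add: J_def\<close>)
  then have "coeff (\<Sum>j<N. c j * Q ^ j) (m * degree Q) = coeff (c m * Q ^ m) (m * degree Q)"
    using m(1) by (subst coeff_sum, subst sum.remove[of _ m]) (auto simp: J_def)
  also have "\<dots> \<noteq> 0"
    using m(1) \<open>Q \<noteq> 0\<close> deg[OF m(1)]
    by (metis (mono_tags, lifting) J_def degree_mpol_poly_mult(2) degree_mpol_poly_power(2)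
        leading_coeff_0_iff mem_Collect_eq)
  finally show False
    using zero by simp
qed

section \<open>Weights\<close>

definition nat_mult :: "nat \<Rightarrow> 'g::comm_monoid_add \<Rightarrow> 'g" (infixr \<open>\<cdot>\<close> 75) where
  "n \<cdot> x = (\<Sum>_<n. x)"

lemma nat_mult_zero_left [simp]: "0 \<cdot> x = 0"
  and nat_mult_Suc: "Suc n \<cdot> x = n \<cdot> x + x"
  by (simp_all add: nat_mult_def)

lemma nat_mult_zero_right [simp]: "n \<cdot> 0 = 0"
  by (simp add: nat_mult_def)

lemma nat_mult_add_left: "(m + n) \<cdot> x = m \<cdot> x + n \<cdot> x"
  by (induction n) (simp_all add: nat_mult_Suc add.assoc)

lemma nat_mult_add_right: "n \<cdot> (x + y) = n \<cdot> x + n \<cdot> y"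
  by (simp add: nat_mult_def sum.distrib)

lemma nat_mult_sum: "n \<cdot> (\<Sum>i\<in>A. f i) = (\<Sum>i\<in>A. n \<cdot> f i)"
  by (induction A rule: infinite_finite_induct) (simp_all add: nat_mult_add_right)

lemma nat_mult_mult: "m \<cdot> n \<cdot> x = (m * n) \<cdot> x"
  by (induction m) (simp_all add: nat_mult_Suc nat_mult_add_left add.commute)

lemma nat_mult_left_commute: "m \<cdot> n \<cdot> x = n \<cdot> m \<cdot> x"
  by (simp add: nat_mult_mult mult.commute)

lemma nat_mult_mono: "x \<le> y \<Longrightarrow> n \<cdot> x \<le> n \<cdot> y" for x :: "'g::linordered_ab_group_add"
  by (simp add: nat_mult_def sum_mono)

lemma nat_mult_strict_mono: "0 < n \<Longrightarrow> x < y \<Longrightarrow> n \<cdot> x < n \<cdot> y"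
  for x :: "'g::linordered_ab_group_add"
  unfolding nat_mult_def by (rule sum_strict_mono) auto

lemma nat_mult_less_iff: "0 < n \<Longrightarrow> n \<cdot> x < n \<cdot> y \<longleftrightarrow> x < y"
  for x :: "'g::linordered_ab_group_add"
  using nat_mult_strict_mono[of n x y] nat_mult_mono[of y x n] by (auto simp flip: not_less)

lemma nat_mult_le_iff: "0 < n \<Longrightarrow> n \<cdot> x \<le> n \<cdot> y \<longleftrightarrow> x \<le> y"
  for x :: "'g::linordered_ab_group_add"
  using nat_mult_less_iff[of n y x] by (simp flip: not_less)

lemma nat_mult_eq_iff: "0 < n \<Longrightarrow> n \<cdot> x = n \<cdot> y \<longleftrightarrow> x = y"
  for x :: "'g::linordered_ab_group_add"
  by (simp add: order_eq_iff nat_mult_le_iff)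

text \<open>
  A minimum of the quotients \<open>x / n\<close>. The group need not be divisible, so quotients are compared by
  cross-multiplication.
\<close>

lemma least_quotient_exists:
  fixes P :: "('g::linordered_ab_group_add \<times> nat) set"
  assumes "finite P" "P \<noteq> {}" "\<And>x n. (x, n) \<in> P \<Longrightarrow> 0 < n"
  shows "\<exists>(x\<^sub>0, n\<^sub>0)\<in>P. \<forall>(x, n)\<in>P. n \<cdot> x\<^sub>0 \<le> n\<^sub>0 \<cdot> x"
  using assms
proof (induction P rule: finite_ne_induct)
  case (insert y P)
  obtain x' n' where y: "y = (x', n')"
    by (rule prod.exhaust)
  obtain x\<^sub>0 n\<^sub>0 where min: "(x\<^sub>0, n\<^sub>0) \<in> P" "\<And>x n. (x, n) \<in> P \<Longrightarrow> n \<cdot> x\<^sub>0 \<le> n\<^sub>0 \<cdot> x"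
    using insert.IH insert.prems by blast
  have pos: "0 < n'" "0 < n\<^sub>0"
    using insert.prems y min by auto
  show ?case
  proof (cases "n' \<cdot> x\<^sub>0 \<le> n\<^sub>0 \<cdot> x'")
    case True
    then show ?thesis
      using min y by (intro bexI[of _ "(x\<^sub>0, n\<^sub>0)"]) auto
  next
    case False
    have "n \<cdot> x' \<le> n' \<cdot> x" if "(x, n) \<in> P" for x n
    proof -
      have "n\<^sub>0 \<cdot> n \<cdot> x' = n \<cdot> n\<^sub>0 \<cdot> x'"
        by (rule nat_mult_left_commute)
      also have "\<dots> \<le> n \<cdot> n' \<cdot> x\<^sub>0"
        using False by (intro nat_mult_mono) simp
      also have "\<dots> = n' \<cdot> n \<cdot> x\<^sub>0"
        by (rule nat_mult_left_commute)
      also have "\<dots> \<le> n' \<cdot> n\<^sub>0 \<cdot> x"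
        using min(2)[OF that] by (rule nat_mult_mono)
      also have "\<dots> = n\<^sub>0 \<cdot> n' \<cdot> x"
        by (rule nat_mult_left_commute)
      finally show ?thesis
        using pos by (simp add: nat_mult_le_iff)
    qed
    then show ?thesis
      using y by (intro bexI[of _ "(x', n')"]) auto
  qed
qed auto

lemma wt_eq: "wt w a = (\<Sum>i\<in>UNIV. Poly_Mapping.lookup a i \<cdot> w i)"
  by (simp add: wt_def nat_mult_def)

lemma wt_add: "wt w (a + b) = wt w a + wt w b"
  by (simp add: wt_eq lookup_add nat_mult_add_left sum.distrib)

lemma wdeg_FinD:
  assumes "wdeg w f = Fin d"
  shows "f \<noteq> 0" "\<And>a. a \<in> Poly_Mapping.keys f \<Longrightarrow> wt w a \<le> d"
    "\<exists>a\<in>Poly_Mapping.keys f. wt w a = d"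
proof -
  show nz: "f \<noteq> 0"
    using assms by (auto simp: wdeg_def)
  then have d: "d = Max (wt w ` Poly_Mapping.keys f)"
    using assms by (simp add: wdeg_def supp_def)
  have ne: "wt w ` Poly_Mapping.keys f \<noteq> {}"
    using nz by simp
  show "wt w a \<le> d" if "a \<in> Poly_Mapping.keys f" for a
    unfolding d using that by (intro Max_ge) simp_all
  have "d \<in> wt w ` Poly_Mapping.keys f"
    unfolding d using ne by (intro Max_in) auto
  then show "\<exists>a\<in>Poly_Mapping.keys f. wt w a = d"
    by blast
qed

lemma lookup_initial_form:
  assumes "wdeg w f = Fin d"
  shows "Poly_Mapping.lookup (initial_form w f) a =
    (if wt w a = d then Poly_Mapping.lookup f a else 0)"
  unfolding initial_form_def assms
  by (auto simp: lookup_sum lookup_single when_def sum.delta supp_def in_keys_iff)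

section \<open>Leading parts\<close>

text \<open>
  A monomial of \<open>k[x][z]\<close> is given by its exponent \<open>j\<close> of \<open>z\<close> and its exponent vector \<open>a\<close>, and
  \<open>\<omega> j a\<close> is its weight.
\<close>

definition terms_in ::
  "(nat \<Rightarrow> ('i \<Rightarrow>\<^sub>0 nat) \<Rightarrow> 'g) \<Rightarrow> 'g set \<Rightarrow> ('i, 'k::comm_ring_1) mpol poly set" where
  "terms_in \<omega> X = {P. \<forall>j. \<forall>a\<in>Poly_Mapping.keys (coeff P j). \<omega> j a \<in> X}"

lemma terms_in_zero: "0 \<in> terms_in \<omega> X"
  by (simp add: terms_in_def)

lemma terms_in_add: "P \<in> terms_in \<omega> X \<Longrightarrow> Q \<in> terms_in \<omega> X \<Longrightarrow> P + Q \<in> terms_in \<omega> X"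
  using keys_add by (fastforce simp: terms_in_def)

lemma terms_in_mono: "P \<in> terms_in \<omega> X \<Longrightarrow> X \<subseteq> Y \<Longrightarrow> P \<in> terms_in \<omega> Y"
  by (auto simp: terms_in_def)

lemma terms_in_mult:
  assumes \<omega>: "\<And>i j a b. \<omega> (i + j) (a + b) = \<omega> i a + (\<omega> j b :: 'g::ab_group_add)"
    and P: "P \<in> terms_in \<omega> X" and Q: "Q \<in> terms_in \<omega> Y"
    and Z: "\<And>x y. x \<in> X \<Longrightarrow> y \<in> Y \<Longrightarrow> x + y \<in> Z"
  shows "P * Q \<in> terms_in \<omega> Z"
  unfolding terms_in_def
proof (clarify)
  fix j c
  assume "c \<in> Poly_Mapping.keys (coeff (P * Q) j)"
  then have "(\<Sum>i\<le>j. Poly_Mapping.lookup (coeff P i * coeff Q (j - i)) c) \<noteq> 0"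
    by (simp add: coeff_mult lookup_sum in_keys_iff)
  then obtain i where i: "i \<le> j" "c \<in> Poly_Mapping.keys (coeff P i * coeff Q (j - i))"
    by (metis (no_types, lifting) atMost_iff in_keys_iff sum.neutral)
  then obtain a b where "c = a + b" "a \<in> Poly_Mapping.keys (coeff P i)"
    "b \<in> Poly_Mapping.keys (coeff Q (j - i))"
    using keys_mult by blast
  moreover have "\<omega> j (a + b) = \<omega> i a + \<omega> (j - i) b"
    using \<omega>[of i "j - i" a b] i(1) by simp
  ultimately show "\<omega> j c \<in> Z"
    using P Q Z by (auto simp: terms_in_def)
qed

locale additive_weight =
  fixes \<omega> :: "nat \<Rightarrow> ('i \<Rightarrow>\<^sub>0 nat) \<Rightarrow> 'g::linordered_ab_group_add"
  assumes weight_add: "\<omega> (i + j) (a + b) = \<omega> i a + \<omega> j b"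
begin

text \<open>
  All terms of \<open>P\<close> have weight at most \<open>D\<close>, and \<open>Q\<close> is the component of weight \<open>D\<close>. The bound
  need not be attained, in which case \<open>Q = 0\<close>. This freedom makes the relation compatible with
  sums, where top terms may cancel.
\<close>

definition leading_part :: "'g \<Rightarrow> ('i, 'k::comm_ring_1) mpol poly \<Rightarrow> ('i, 'k) mpol poly \<Rightarrow> bool" where
  "leading_part D P Q \<longleftrightarrow> Q \<in> terms_in \<omega> {D} \<and> P - Q \<in> terms_in \<omega> {..<D}"

lemma leading_part_zero: "leading_part D 0 0"
  by (simp add: leading_part_def terms_in_zero)

lemma leading_part_add:
  assumes "leading_part D P Q" "leading_part D P' Q'"
  shows "leading_part D (P + P') (Q + Q')"
  using assms terms_in_add[of "P - Q" \<omega> "{..<D}" "P' - Q'"]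
  by (simp add: leading_part_def terms_in_add algebra_simps)

lemma leading_part_sum:
  assumes "\<And>x. x \<in> A \<Longrightarrow> leading_part D (P x) (Q x)"
  shows "leading_part D (\<Sum>x\<in>A. P x) (\<Sum>x\<in>A. Q x)"
  using assms
  by (induction A rule: infinite_finite_induct) (simp_all add: leading_part_zero leading_part_add)

lemma leading_part_mult:
  assumes "leading_part D P Q" "leading_part E P' Q'"
  shows "leading_part (D + E) (P * P') (Q * Q')"
proof -
  note mult = terms_in_mult[where \<omega> = \<omega>, OF weight_add]
  have Q: "Q \<in> terms_in \<omega> {D}" "Q' \<in> terms_in \<omega> {E}"
    and R: "P - Q \<in> terms_in \<omega> {..<D}" "P' - Q' \<in> terms_in \<omega> {..<E}"
    using assms by (simp_all add: leading_part_def)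
  have "Q * Q' \<in> terms_in \<omega> {D + E}"
    by (rule mult[OF Q]) simp
  moreover have "Q * (P' - Q') \<in> terms_in \<omega> {..<D + E}"
    by (rule mult[OF Q(1) R(2)]) simp
  moreover have "(P - Q) * Q' \<in> terms_in \<omega> {..<D + E}"
    by (rule mult[OF R(1) Q(2)]) simp
  moreover have "(P - Q) * (P' - Q') \<in> terms_in \<omega> {..<D + E}"
    by (rule mult[OF R]) (simp add: add_strict_mono)
  moreover have "P * P' - Q * Q' = Q * (P' - Q') + (P - Q) * Q' + (P - Q) * (P' - Q')"
    by (simp add: algebra_simps)
  ultimately show ?thesis
    by (simp add: leading_part_def terms_in_add)
qed

lemma leading_part_below:
  assumes "leading_part D P Q" "D < E"
  shows "leading_part E P 0"
proof -
  have "(P - Q) + Q \<in> terms_in \<omega> {..<E}"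
    using assms by (intro terms_in_add) (auto simp: leading_part_def elim!: terms_in_mono)
  then show ?thesis
    by (simp add: leading_part_def terms_in_zero)
qed

lemma leading_part_Const: "leading_part 0 [:Const c:] [:Const c:]"
proof -
  have "\<omega> 0 0 = 0"
    using weight_add[of 0 0 0 0] by simp
  then show ?thesis
    by (auto simp: leading_part_def terms_in_def Const_def coeff_pCons split: nat.splits if_splits)
qed

lemma leading_part_one: "leading_part 0 1 1"
  using leading_part_Const[of 1] by (simp add: Const_def one_pCons)

lemma leading_part_power:
  "leading_part D P Q \<Longrightarrow> leading_part (n \<cdot> D) (P ^ n) (Q ^ n)"
  by (induction n) (simp_all add: leading_part_one leading_part_mult nat_mult_Suc add.commute)

lemma leading_part_prod:
  assumes "\<And>x. x \<in> A \<Longrightarrow> leading_part (D x) (P x) (Q x)"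
  shows "leading_part (\<Sum>x\<in>A. D x) (\<Prod>x\<in>A. P x) (\<Prod>x\<in>A. Q x)"
  using assms
  by (induction A rule: infinite_finite_induct) (simp_all add: leading_part_one leading_part_mult)

lemma leading_part_coeff_eq_0:
  assumes "leading_part D P Q" "coeff P j = 0"
  shows "coeff Q j = 0"
proof (rule poly_mapping_eqI)
  fix a
  have False if a: "a \<in> Poly_Mapping.keys (coeff Q j)"
  proof -
    have "a \<in> Poly_Mapping.keys (coeff (P - Q) j)"
      using a assms(2) by (simp add: in_keys_iff)
    then have "\<omega> j a < D" "\<omega> j a = D"
      using assms(1) a unfolding leading_part_def terms_in_def by blast+
    then show False
      by simp
  qed
  then show "Poly_Mapping.lookup (coeff Q j) a = Poly_Mapping.lookup 0 a"
    by (auto simp: in_keys_iff)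
qed

lemma leading_part_exists:
  assumes "P \<in> terms_in \<omega> {..D}"
  obtains Q where "leading_part D P Q"
    "\<And>j a. Poly_Mapping.lookup (coeff Q j) a = (if \<omega> j a = D then Poly_Mapping.lookup (coeff P j) a else 0)"
proof -
  define R where "R j = (\<Sum>a\<in>{a\<in>Poly_Mapping.keys (coeff P j). \<omega> j a = D}.
    Poly_Mapping.single a (Poly_Mapping.lookup (coeff P j) a))" for j
  define Q where "Q = (\<Sum>j\<le>degree P. monom (R j) j)"
  have R: "Poly_Mapping.lookup (R j) a = (if \<omega> j a = D then Poly_Mapping.lookup (coeff P j) a else 0)" for j a
    unfolding R_def by (auto simp: lookup_sum lookup_single when_def sum.delta in_keys_iff)
  have "coeff Q j = R j" for j
  proof (cases "j \<le> degree P")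
    case False
    then have "R j = 0"
      by (simp add: R_def coeff_eq_0)
    then show ?thesis
      using False by (auto simp: Q_def coeff_sum)
  qed (simp add: Q_def coeff_sum)
  then have Q: "Poly_Mapping.lookup (coeff Q j) a = (if \<omega> j a = D then Poly_Mapping.lookup (coeff P j) a else 0)" for j a
    by (simp add: R)
  have "\<omega> j a < D" if "a \<in> Poly_Mapping.keys (coeff (P - Q) j)" for j a
  proof -
    have "\<omega> j a \<noteq> D" "a \<in> Poly_Mapping.keys (coeff P j)"
      using that by (auto simp: in_keys_iff Q lookup_minus split: if_splits)
    then show ?thesis
      using assms by (auto simp: terms_in_def order_le_less)
  qed
  then have "leading_part D P Q"
    by (auto simp: leading_part_def terms_in_def in_keys_iff Q split: if_splits)
  then show ?thesis
    using that Q by blast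
qed

text \<open>
  If \<open>q\<close> is the leading part of \<open>p\<close>, then substituting \<open>p\<close> into a monomial of weight \<open>e\<close> gives
  terms of weight at most \<open>n \<cdot> e\<close>, the top ones being the substitution of \<open>q\<close>. So only the monomials
  of \<open>f\<close> of maximal weight reach the weight \<open>n \<cdot> d\<close>. In the application \<open>n\<close> clears the
  denominator of the weight of \<open>z\<close>.
\<close>

lemma leading_part_eval:
  fixes p q :: "'j::finite \<Rightarrow> ('i, 'k::comm_ring_1) mpol poly"
  assumes lead: "\<And>j. leading_part (n \<cdot> w j) (p j) (q j)" and "0 < n"
    and d: "wdeg w f = Fin d"
  shows "leading_part (n \<cdot> d) (eval_mpol (\<lambda>c. [:Const c:]) p f)
    (eval_mpol (\<lambda>c. [:Const c:]) q (initial_form w f))"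
proof -
  let ?h = "\<lambda>c. [:Const c:] :: ('i, 'k) mpol poly"
  interpret unital_ring_hom ?h
    by (rule unital_ring_hom_compose[OF unital_ring_hom_constant_poly unital_ring_hom_Const])
  have monom: "leading_part (n \<cdot> wt w a) (monomial_value p a) (monomial_value q a)" for a
  proof -
    have "leading_part (\<Sum>j\<in>UNIV. Poly_Mapping.lookup a j \<cdot> n \<cdot> w j) (monomial_value p a) (monomial_value q a)"
      unfolding monomial_value_superset[OF finite_class.finite_UNIV subset_UNIV]
      by (intro leading_part_prod leading_part_power lead)
    then show ?thesis
      by (simp add: wt_eq nat_mult_sum nat_mult_left_commute[of n])
  qed
  have summand: "leading_part (n \<cdot> d) (?h (Poly_Mapping.lookup f a) * monomial_value p a)
      (?h (Poly_Mapping.lookup (initial_form w f) a) * monomial_value q a)"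
    if "a \<in> Poly_Mapping.keys f" for a
  proof -
    note L = leading_part_mult[OF leading_part_Const[of "Poly_Mapping.lookup f a"] monom[of a]]
    show ?thesis
    proof (cases "wt w a = d")
      case True
      then show ?thesis
        using L d by (simp add: lookup_initial_form)
    next
      case False
      then have "n \<cdot> wt w a < n \<cdot> d"
        using wdeg_FinD(2)[OF d that] \<open>0 < n\<close> by (simp add: nat_mult_less_iff)
      then show ?thesis
        using leading_part_below[OF L] False d by (simp add: lookup_initial_form zero)
    qed
  qed
  have "Poly_Mapping.keys (initial_form w f) \<subseteq> Poly_Mapping.keys f"
    using d by (auto simp: in_keys_iff lookup_initial_form split: if_splits)
  then show ?thesis
    using leading_part_sum[OF summand]
    by (subst eval_mpol_superset[of "Poly_Mapping.keys f" "initial_form w f"])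
       (simp_all add: eval_mpol_def)
qed

end

section \<open>Algebraic dependence by counting monomials\<close>

text \<open>
  Gaussian elimination without division: the pivot row is subtracted after cross-multiplication,
  and the pivot unknown is recovered by scaling the others by the pivot.
\<close>

lemma homogeneous_system_nontrivial_solution:
  fixes M :: "'s \<Rightarrow> 't \<Rightarrow> 'k::idom"
  assumes "finite T" "finite I" "card T < card I"
  shows "\<exists>c. (\<exists>i\<in>I. c i \<noteq> 0) \<and> (\<forall>t\<in>T. (\<Sum>i\<in>I. c i * M i t) = 0)"
  using assms
proof (induction T arbitrary: I M rule: finite_induct)
  case empty
  then have "I \<noteq> {}"
    by auto
  then show ?case
    by (intro exI[of _ "\<lambda>_. 1"]) auto
next
  case (insert t T)
  show ?case
  proof (cases "\<forall>i\<in>I. M i t = 0")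
    case True
    have "card T < card I"
      using insert.prems insert.hyps by simp
    from insert.IH[OF insert.prems(1) this, of M] obtain c
      where c: "\<exists>i\<in>I. c i \<noteq> 0" "\<forall>t\<in>T. (\<Sum>i\<in>I. c i * M i t) = 0"
      by (elim exE conjE) (rule that)
    moreover have "(\<Sum>i\<in>I. c i * M i t) = 0"
      using True by simp
    ultimately show ?thesis
      by (intro exI[of _ c]) simp
  next
    case False
    then obtain k where k: "k \<in> I" "M k t \<noteq> 0"
      by auto
    define I' where "I' = I - {k}"
    have I': "finite I'" "card T < card I'"
      using insert.prems insert.hyps k by (auto simp: I'_def)
    from insert.IH[OF I', of "\<lambda>i s. M k t * M i s - M i t * M k s"] obtain c
      where c: "\<exists>i\<in>I'. c i \<noteq> 0"
        "\<forall>s\<in>T. (\<Sum>i\<in>I'. c i * (M k t * M i s - M i t * M k s)) = 0"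
      by (elim exE conjE) (rule that)
    define b where "b i = (if i = k then - (\<Sum>i\<in>I'. c i * M i t) else c i * M k t)" for i
    have b: "(\<Sum>i\<in>I. b i * M i s) = (\<Sum>i\<in>I'. c i * (M k t * M i s - M i t * M k s))" for s
    proof -
      have "(\<Sum>i\<in>I. b i * M i s) = b k * M k s + (\<Sum>i\<in>I'. b i * M i s)"
        using insert.prems k unfolding I'_def by (intro sum.remove)
      also have "(\<Sum>i\<in>I'. b i * M i s) = (\<Sum>i\<in>I'. c i * M k t * M i s)"
        by (intro sum.cong) (auto simp: b_def I'_def)
      also have "b k * M k s = - (\<Sum>i\<in>I'. c i * M i t * M k s)"
        by (simp add: b_def sum_distrib_right)
      finally show ?thesis
        by (simp add: algebra_simps sum_subtractf)
    qed
    have "(\<Sum>i\<in>I. b i * M i s) = 0" if "s \<in> insert t T" for s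
    proof (cases "s = t")
      case True
      then show ?thesis
        unfolding b by (simp add: mult.commute)
    next
      case False
      then show ?thesis
        unfolding b using c(2) that by blast
    qed
    moreover have "\<exists>i\<in>I. b i \<noteq> 0"
    proof -
      obtain i where "i \<in> I'" "c i \<noteq> 0"
        using c(1) by blast
      then show ?thesis
        using k by (intro bexI[of _ i]) (auto simp: b_def I'_def)
    qed
    ultimately show ?thesis
      by (intro exI[of _ b]) simp
  qed
qed

definition exponents_le :: "nat \<Rightarrow> ('i, 'k::comm_ring_1) mpol \<Rightarrow> bool" where
  "exponents_le d f \<longleftrightarrow> (\<forall>a\<in>Poly_Mapping.keys f. \<forall>i. Poly_Mapping.lookup a i \<le> d)"

lemma exponents_le_mono: "exponents_le d f \<Longrightarrow> d \<le> e \<Longrightarrow> exponents_le e f"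
  unfolding exponents_le_def using order_trans by blast

lemma exponents_le_one: "exponents_le 0 1"
  by (simp add: exponents_le_def)

lemma exponents_le_mult:
  assumes "exponents_le d f" "exponents_le e g"
  shows "exponents_le (d + e) (f * g)"
  unfolding exponents_le_def
proof (intro ballI allI)
  fix c i
  assume "c \<in> Poly_Mapping.keys (f * g)"
  then obtain a b where "c = a + b" "a \<in> Poly_Mapping.keys f" "b \<in> Poly_Mapping.keys g"
    using keys_mult by blast
  then show "Poly_Mapping.lookup c i \<le> d + e"
    using assms by (simp add: exponents_le_def lookup_add add_mono)
qed

lemma exponents_le_power: "exponents_le d f \<Longrightarrow> exponents_le (n * d) (f ^ n)"
  by (induction n) (simp_all add: exponents_le_one exponents_le_mult)

lemma exponents_le_prod:
  assumes "\<And>x. x \<in> A \<Longrightarrow> exponents_le (d x) (f x)"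
  shows "exponents_le (\<Sum>x\<in>A. d x) (\<Prod>x\<in>A. f x)"
  using assms
  by (induction A rule: infinite_finite_induct) (simp_all add: exponents_le_one exponents_le_mult)

lemma exponents_le_exists:
  fixes X :: "('i::finite, 'k::comm_ring_1) mpol set"
  assumes "finite X"
  shows "\<exists>d. \<forall>f\<in>X. exponents_le d f"
proof -
  let ?E = "\<Union>f\<in>X. \<Union>a\<in>Poly_Mapping.keys f. Set.range (Poly_Mapping.lookup a)"
  have "finite ?E"
    using assms by simp
  then have "Poly_Mapping.lookup a i \<le> Max ?E"
    if "f \<in> X" "a \<in> Poly_Mapping.keys f" for f a i
    by (rule Max_ge) (use that in blast)
  then show ?thesis
    by (intro exI[of _ "Max ?E"]) (simp add: exponents_le_def)
qed

lemma card_bounded_exponents: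
  shows "finite {a :: 'i::finite \<Rightarrow>\<^sub>0 nat. \<forall>i. Poly_Mapping.lookup a i \<le> d}"
    and "card {a :: 'i::finite \<Rightarrow>\<^sub>0 nat. \<forall>i. Poly_Mapping.lookup a i \<le> d} \<le> Suc d ^ CARD('i)"
proof -
  let ?A = "{a :: 'i \<Rightarrow>\<^sub>0 nat. \<forall>i. Poly_Mapping.lookup a i \<le> d}"
  let ?E = "PiE (UNIV :: 'i set) (\<lambda>_. {..d})"
  have inj: "inj_on Poly_Mapping.lookup ?A"
    by (simp add: inj_on_def)
  have sub: "Poly_Mapping.lookup ` ?A \<subseteq> ?E"
    by auto
  have "finite ?E"
    by (intro finite_PiE) simp_all
  then show "finite ?A"
    by (rule inj_on_finite[OF inj sub])
  show "card ?A \<le> Suc d ^ CARD('i)"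
    using card_inj_on_le[OF inj sub \<open>finite ?E\<close>] by (simp add: card_PiE)
qed

lemma lookup_Const_mult:
  "Poly_Mapping.lookup (Const c * f) a = c * Poly_Mapping.lookup f a"
proof -
  have "Const c * f = Poly_Mapping.map ((*) c) f"
    by (simp add: Const_def mult_map_scale_conv_mult)
  then show ?thesis
    by (simp add: Poly_Mapping.map.rep_eq when_def)
qed

text \<open>
  Any \<open>y\<close> is algebraic over \<open>k[p\<^sub>j]\<close> once there are at least as many \<open>p\<^sub>j\<close> as variables and
  the \<open>p\<^sub>j\<close> are independent. With exponents below \<open>N\<close>, the products of powers of the \<open>p\<^sub>j\<close> and of \<open>y\<close>
  number \<open>N ^ (card J + 1)\<close>, but they lie in the span of \<open>O(N ^ CARD('n))\<close> monomials. For large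
  \<open>N\<close> there is a linear relation. It is returned as a polynomial in \<open>y\<close>, with coefficients
  \<open>F l\<close> that are not all zero as polynomials in the \<open>p\<^sub>j\<close>.
\<close>

lemma algebraic_dependence:
  fixes p :: "'j \<Rightarrow> ('n::finite, 'k::idom) mpol" and y :: "('n, 'k) mpol"
  assumes "finite J" "CARD('n) \<le> card J"
  obtains N F where "\<And>l. l < N \<Longrightarrow> vars (F l) \<subseteq> J" "\<exists>l<N. F l \<noteq> 0"
    "(\<Sum>l<N. subst_mpol p (F l) * y ^ l) = 0"
proof -
  let ?n = "CARD('n)"
  interpret Const: unital_ring_hom Const
    by (rule unital_ring_hom_Const)
  obtain d where "\<forall>f\<in>insert y (p ` J). exponents_le d f"
    using exponents_le_exists[of "insert y (p ` J)"] assms(1) by blast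
  then have d: "exponents_le d y" "\<And>j. j \<in> J \<Longrightarrow> exponents_le d (p j)"
    by simp_all
  define s where "s = Suc (card J)"
  \<comment> \<open>Chosen so that \<open>(s * N * d + 1) ^ ?n \<le> (s * d + 1) ^ ?n * N ^ ?n < N * N ^ ?n\<close>.\<close>
  define N where "N = Suc (Suc (s * d) ^ ?n)"
  define E where "E = PiE J (\<lambda>_. {..<N})"
  define T where "T = {a :: 'n \<Rightarrow>\<^sub>0 nat. \<forall>i. Poly_Mapping.lookup a i \<le> s * (N * d)}"
  \<comment> \<open>Exponent vectors supported on \<open>J\<close> are indexed by functions, whose number is known.\<close>
  define e where "e g = (\<Sum>j\<in>J. Poly_Mapping.single j (g j :: nat))" for g
  have e: "Poly_Mapping.lookup (e g) j = (if j \<in> J then g j else 0)" for g j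
    using assms(1) by (simp add: e_def lookup_sum lookup_single when_def)
  have keys_e: "Poly_Mapping.keys (e g) \<subseteq> J" for g
    by (auto simp: in_keys_iff e split: if_splits)
  have inj_e: "g = g'" if "g \<in> E" "g' \<in> E" "e g = e g'" for g g'
  proof (rule PiE_ext)
    show "g \<in> PiE J (\<lambda>_. {..<N})" "g' \<in> PiE J (\<lambda>_. {..<N})"
      using that by (simp_all add: E_def)
    show "g j = g' j" if "j \<in> J" for j
      using e[of g j] e[of g' j] \<open>e g = e g'\<close> that by simp
  qed
  have "finite E"
    unfolding E_def using assms(1) by (intro finite_PiE) simp_all
  have bound: "exponents_le (s * (N * d)) (monomial_value p (e g) * y ^ l)" if "g \<in> E" "l < N" for g l
  proof -
    have "exponents_le (N * d) (p j ^ g j)" if "j \<in> J" for j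
    proof (rule exponents_le_mono)
      show "exponents_le (g j * d) (p j ^ g j)"
        using d(2) that by (intro exponents_le_power)
      have "g j < N"
        using \<open>g \<in> E\<close> that by (auto simp: E_def)
      then show "g j * d \<le> N * d"
        by simp
    qed
    then have "exponents_le (\<Sum>j\<in>J. N * d) (\<Prod>j\<in>J. p j ^ g j)"
      by (rule exponents_le_prod)
    moreover have "monomial_value p (e g) = (\<Prod>j\<in>J. p j ^ g j)"
      using monomial_value_superset[OF assms(1) keys_e] by (simp add: e)
    moreover have "exponents_le (N * d) (y ^ l)"
      using exponents_le_power[OF d(1), of l] by (rule exponents_le_mono) (use that in simp)
    ultimately have "exponents_le (card J * (N * d) + N * d) (monomial_value p (e g) * y ^ l)"
      by (simp add: exponents_le_mult)
    then show ?thesis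
      by (simp add: s_def add.commute)
  qed
  have fewer: "card T < card (E \<times> {..<N})"
  proof -
    have "1 \<le> N"
      by (simp add: N_def)
    have "card T \<le> Suc (s * (N * d)) ^ ?n"
      unfolding T_def by (rule card_bounded_exponents)
    also have "\<dots> \<le> (Suc (s * d) * N) ^ ?n"
      using \<open>1 \<le> N\<close> by (intro power_mono) (simp_all add: mult_ac)
    also have "\<dots> = Suc (s * d) ^ ?n * N ^ ?n"
      by (rule power_mult_distrib)
    also have "\<dots> \<le> Suc (s * d) ^ ?n * N ^ card J"
      using assms(2) by (intro mult_left_mono power_increasing) (simp_all add: N_def)
    also have "\<dots> < N * N ^ card J"
      by (simp add: N_def)
    also have "\<dots> = card (E \<times> {..<N})"
      using assms(1) by (simp add: E_def card_PiE card_cartesian_product)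
    finally show ?thesis .
  qed
  have fin: "finite T" "finite (E \<times> {..<N})"
    using \<open>finite E\<close> by (simp_all add: T_def card_bounded_exponents)
  obtain c where c: "\<exists>x\<in>E \<times> {..<N}. c x \<noteq> 0"
    "\<forall>t\<in>T. (\<Sum>x\<in>E \<times> {..<N}. c x *
      Poly_Mapping.lookup (monomial_value p (e (fst x)) * y ^ snd x) t) = 0"
    using homogeneous_system_nontrivial_solution[OF fin fewer, of
        "\<lambda>x. Poly_Mapping.lookup (monomial_value p (e (fst x)) * y ^ snd x)"]
    by (elim exE conjE) (rule that)
  define F where "F l = (\<Sum>g\<in>E. Poly_Mapping.single (e g) (c (g, l)))" for l
  show ?thesis
  proof (rule that)
    show "vars (F l) \<subseteq> J" for l
    proof -
      have "\<exists>g\<in>E. a = e g" if "a \<in> Poly_Mapping.keys (F l)" for a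
      proof (rule ccontr)
        assume "\<not> (\<exists>g\<in>E. a = e g)"
        then have "Poly_Mapping.lookup (F l) a = 0"
          unfolding F_def lookup_sum by (intro sum.neutral) (auto simp: lookup_single when_def)
        then show False
          using that by (simp add: in_keys_iff)
      qed
      then show ?thesis
        using keys_e unfolding vars_def supp_def by blast
    qed
    show "\<exists>l<N. F l \<noteq> 0"
    proof -
      obtain g l where gl: "g \<in> E" "l < N" "c (g, l) \<noteq> 0"
        using c(1) by auto
      have "Poly_Mapping.lookup (F l) (e g) = (\<Sum>g'\<in>E. if g' = g then c (g', l) else 0)"
        unfolding F_def lookup_sum
        by (intro sum.cong) (use gl inj_e in \<open>auto simp: lookup_single when_def\<close>)
      also have "\<dots> \<noteq> 0"
        using gl \<open>finite E\<close> by simp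
      finally show ?thesis
        using gl by auto
    qed
    have "(\<Sum>l<N. subst_mpol p (F l) * y ^ l) =
        (\<Sum>l<N. \<Sum>g\<in>E. Const (c (g, l)) * (monomial_value p (e g) * y ^ l))"
      by (simp add: F_def subst_mpol_eq_eval Const.eval_mpol_sum Const.eval_mpol_single
          sum_distrib_right mult.assoc)
    also have "\<dots> = (\<Sum>x\<in>E \<times> {..<N}. Const (c x) * (monomial_value p (e (fst x)) * y ^ snd x))"
      by (subst sum.swap) (simp add: sum.cartesian_product case_prod_unfold)
    also have "\<dots> = 0"
    proof (rule poly_mapping_eqI)
      fix t
      show "Poly_Mapping.lookup (\<Sum>x\<in>E \<times> {..<N}.
          Const (c x) * (monomial_value p (e (fst x)) * y ^ snd x)) t = Poly_Mapping.lookup 0 t"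
      proof (cases "t \<in> T")
        case True
        then show ?thesis
          using c(2) by (simp add: lookup_sum lookup_Const_mult)
      next
        case False
        have "Poly_Mapping.lookup (monomial_value p (e (fst x)) * y ^ snd x) t = 0"
          if "x \<in> E \<times> {..<N}" for x
        proof -
          have "exponents_le (s * (N * d)) (monomial_value p (e (fst x)) * y ^ snd x)"
            using that by (intro bound) auto
          then show ?thesis
            using False by (auto simp: exponents_le_def T_def in_keys_iff)
        qed
        then show ?thesis
          by (simp add: lookup_sum lookup_Const_mult)
      qed
    qed
    finally show "(\<Sum>l<N. subst_mpol p (F l) * y ^ l) = 0" .
  qed
qed

section \<open>Initial forms of elements of \<open>k[x]\<^sup>\<phi>\<close>\<close>

lemma z_free_zero: "0 \<in> z_free"
  and z_free_one: "1 \<in> z_free"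
  and z_free_add: "P \<in> z_free \<Longrightarrow> Q \<in> z_free \<Longrightarrow> P + Q \<in> z_free"
  and z_free_mult: "P \<in> z_free \<Longrightarrow> Q \<in> z_free \<Longrightarrow> P * Q \<in> z_free"
  for P Q :: "'a::comm_ring_1 poly"
  by (auto simp: z_free_def image_iff one_pCons)

lemma z_free_sum: "(\<And>i. i \<in> A \<Longrightarrow> P i \<in> z_free) \<Longrightarrow> (\<Sum>i\<in>A. P i) \<in> z_free"
  for P :: "'i \<Rightarrow> 'a::comm_ring_1 poly"
  by (induction A rule: infinite_finite_induct) (simp_all add: z_free_zero z_free_add)

lemma z_free_prod: "(\<And>i. i \<in> A \<Longrightarrow> P i \<in> z_free) \<Longrightarrow> (\<Prod>i\<in>A. P i) \<in> z_free"
  for P :: "'i \<Rightarrow> 'a::comm_ring_1 poly"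
  by (induction A rule: infinite_finite_induct) (simp_all add: z_free_one z_free_mult)

lemma z_free_power: "P \<in> z_free \<Longrightarrow> P ^ n \<in> z_free" for P :: "'a::comm_ring_1 poly"
  by (induction n) (simp_all add: z_free_one z_free_mult)

lemma z_free_eval_mpol:
  assumes "\<And>j. j \<in> vars F \<Longrightarrow> p j \<in> z_free"
  shows "eval_mpol (\<lambda>c. [:h c:]) p F \<in> z_free"
  unfolding eval_mpol_def monomial_value_def
  by (intro z_free_sum z_free_mult z_free_prod z_free_power assms)
    (auto simp: z_free_def vars_def supp_def)

text \<open>
  A supremum of natural numbers that is finite and positive is attained.
\<close>

lemma trans_deg_attained:
  assumes "trans_deg A = enat n" "0 < n"
  obtains B where "B \<subseteq> A" "finite B" "alg_indep_on B (\<lambda>b. b)" "n \<le> card B"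
proof (rule ccontr)
  assume none: "\<not> thesis"
  have "trans_deg A \<le> enat (n - 1)"
    unfolding trans_deg_def
  proof (rule SUP_least)
    fix B
    assume "B \<in> {B. B \<subseteq> A \<and> finite B \<and> alg_indep_on B (\<lambda>b. b)}"
    then have "\<not> n \<le> card B"
      using none that by blast
    then show "enat (card B) \<le> enat (n - 1)"
      by simp
  qed
  then show False
    using assms by simp
qed

text \<open>
  Give \<open>z\<close> the weight \<open>u / n\<close> which is the largest one for which no term of any \<open>p i\<close> exceeds the
  weight \<open>w i\<close> of its constant term. If \<open>z\<^sup>j\<close>, \<open>j > 0\<close>, has in \<open>p i\<close> a coefficient of degree \<open>d\<close>, this
  bounds the weight of \<open>z\<close> by \<open>(w i - d) / j\<close>. So the least of these quotients is the right choice, and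
  where it is attained a term with a positive power of \<open>z\<close> survives in the leading part. Multiplying
  all weights by the denominator \<open>n\<close> keeps them in the group.
\<close>

lemma critical_weight:
  fixes p :: "'n::finite \<Rightarrow> ('m::finite, 'k::comm_ring_1) mpol poly"
    and v :: "'m \<Rightarrow> 'g::linordered_ab_group_add"
  assumes w: "\<And>i. wdeg v (coeff (p i) 0) = Fin (w i)" and nonconst: "\<exists>i. p i \<notin> z_free"
  obtains n and u :: 'g and q and k where "0 < n"
    "\<And>i. additive_weight.leading_part (\<lambda>j a. n \<cdot> wt v a + j \<cdot> u) (n \<cdot> w i) (p i) (q i)"
    "\<And>i. coeff (q i) 0 = initial_form v (coeff (p i) 0)" "q k \<notin> z_free"
proof -
  define d where "d i j = Max (wt v ` Poly_Mapping.keys (coeff (p i) j))" for i j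
  have d: "wdeg v (coeff (p i) j) = Fin (d i j)" if "coeff (p i) j \<noteq> 0" for i j
    using that by (simp add: wdeg_def d_def supp_def)
  define I where "I = {(i, j). 0 < j \<and> coeff (p i) j \<noteq> 0}"
  let ?r = "\<lambda>(i, j). (w i - d i j, j)"
  have "I \<subseteq> (SIGMA i : UNIV. {..degree (p i)})"
    by (auto simp: I_def intro: le_degree)
  then have "finite I"
    by (rule finite_subset) simp
  have "I \<noteq> {}"
  proof -
    obtain i where "degree (p i) \<noteq> 0"
      using nonconst by (auto simp: z_free_iff)
    then have "(i, degree (p i)) \<in> I"
      by (auto simp: I_def)
    then show ?thesis
      by blast
  qed
  have "\<exists>(x\<^sub>0, n\<^sub>0)\<in>?r ` I. \<forall>(x, n)\<in>?r ` I. n \<cdot> x\<^sub>0 \<le> n\<^sub>0 \<cdot> x"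
    by (rule least_quotient_exists) (use \<open>finite I\<close> \<open>I \<noteq> {}\<close> in \<open>auto simp: I_def\<close>)
  then obtain k n where kn: "(k, n) \<in> I"
    and min: "\<And>i j. (i, j) \<in> I \<Longrightarrow> j \<cdot> (w k - d k n) \<le> n \<cdot> (w i - d i j)"
    by fastforce
  define u where "u = w k - d k n"
  define \<omega> where "\<omega> j a = n \<cdot> wt v a + j \<cdot> u" for j a
  interpret additive_weight \<omega>
    by unfold_locales (simp add: \<omega>_def wt_add nat_mult_add_left nat_mult_add_right add_ac)
  have "0 < n" and kn': "coeff (p k) n \<noteq> 0"
    using kn by (simp_all add: I_def)
  have below: "p i \<in> terms_in \<omega> {..n \<cdot> w i}" for i
    unfolding terms_in_def mem_Collect_eq atMost_iff
  proof (intro allI ballI)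
    fix j a
    assume a: "a \<in> Poly_Mapping.keys (coeff (p i) j)"
    then have nz: "coeff (p i) j \<noteq> 0"
      by auto
    show "\<omega> j a \<le> n \<cdot> w i"
    proof (cases "j = 0")
      case True
      have "wt v a \<le> w i"
        using wdeg_FinD(2)[OF w] a True by simp
      then show ?thesis
        using True by (simp add: \<omega>_def nat_mult_mono)
    next
      case False
      have "\<omega> j a \<le> n \<cdot> d i j + n \<cdot> (w i - d i j)"
        unfolding \<omega>_def u_def
      proof (rule add_mono)
        show "n \<cdot> wt v a \<le> n \<cdot> d i j"
          using wdeg_FinD(2)[OF d[OF nz] a] by (rule nat_mult_mono)
        show "j \<cdot> (w k - d k n) \<le> n \<cdot> (w i - d i j)"
          using False nz by (intro min) (simp add: I_def)
      qed
      then show ?thesis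
        by (simp flip: nat_mult_add_right)
    qed
  qed
  have "\<exists>Q. leading_part (n \<cdot> w i) (p i) Q \<and> (\<forall>j a. Poly_Mapping.lookup (coeff Q j) a =
      (if \<omega> j a = n \<cdot> w i then Poly_Mapping.lookup (coeff (p i) j) a else 0))" for i
    using leading_part_exists[OF below[of i]] by metis
  then obtain q where q: "\<And>i. leading_part (n \<cdot> w i) (p i) (q i)"
    and lookup_q: "\<And>i j a. Poly_Mapping.lookup (coeff (q i) j) a =
      (if \<omega> j a = n \<cdot> w i then Poly_Mapping.lookup (coeff (p i) j) a else 0)"
    by metis
  show ?thesis
  proof (rule that)
    show "0 < n"
      by fact
    show "additive_weight.leading_part (\<lambda>j a. n \<cdot> wt v a + j \<cdot> u) (n \<cdot> w i) (p i) (q i)" for i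
      using q[of i] unfolding \<omega>_def .
    show "coeff (q i) 0 = initial_form v (coeff (p i) 0)" for i
      using \<open>0 < n\<close>
      by (intro poly_mapping_eqI) (simp add: lookup_q lookup_initial_form[OF w] \<omega>_def nat_mult_eq_iff)
    obtain a where a: "a \<in> Poly_Mapping.keys (coeff (p k) n)" "wt v a = d k n"
      using wdeg_FinD(3)[OF d[OF kn']] by blast
    have "\<omega> n a = n \<cdot> w k"
      by (simp add: \<omega>_def u_def a(2) flip: nat_mult_add_right)
    then have "Poly_Mapping.lookup (coeff (q k) n) a \<noteq> 0"
      using a(1) by (simp add: lookup_q in_keys_iff)
    then have "coeff (q k) n \<noteq> 0"
      by auto
    then have "n \<le> degree (q k)"
      by (rule le_degree)
    then show "q k \<notin> z_free"
      using \<open>0 < n\<close> by (simp add: z_free_iff)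
  qed
qed

text \<open>
  Setting \<open>z = 0\<close> already detects nonzero polynomials.
\<close>

lemma eval_algebraically_independent_constant_terms:
  assumes "alg_indep_on UNIV (\<lambda>i. coeff (q i) 0)" "eval_mpol (\<lambda>c. [:Const c:]) q f = 0"
  shows "f = 0"
proof -
  interpret unital_ring_hom "\<lambda>P :: ('b, 'c) mpol poly. coeff P 0"
    by unfold_locales (simp_all add: coeff_mult_0)
  have "subst_mpol (\<lambda>i. coeff (q i) 0) f = coeff (eval_mpol (\<lambda>c. [:Const c:]) q f) 0"
    by (simp add: hom_eval_mpol subst_mpol_eq_eval)
  then show ?thesis
    using assms by (simp add: alg_indep_on_def)
qed

theorem theorem1p2:
  fixes \<phi> :: "('n::finite, 'k::idom) mpol \<Rightarrow> ('m::finite, 'k) mpol poly"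
    and w :: "'n \<Rightarrow> 'g::linordered_ab_group_add"
    and S :: "('n, 'k) mpol set"
  assumes "CARD('m) \<ge> CARD('n)" and "CARD('n) \<ge> 1"
    and "alg_hom \<phi>"
    and "\<not> range \<phi> \<subseteq> z_free"
    and "\<exists>v :: 'm \<Rightarrow> 'g.
           alg_indep_on UNIV (\<lambda>i. initial_form v (poly (\<phi> (Var i)) 0)) \<and>
           (\<forall>i. wdeg v (poly (\<phi> (Var i)) 0) = Fin (w i))"
    and "S \<subseteq> UNIV - {0}"
    and "trans_deg (generated_subalgebra S) = enat CARD('n)"
  shows "\<exists>g\<in>S. \<forall>f\<in>(\<phi> -` z_free) - {0}. \<not> g dvd initial_form w f"
proof (rule ccontr)
  assume "\<not> ?thesis"
  then have divides: "\<exists>f. \<phi> f \<in> z_free \<and> f \<noteq> 0 \<and> g dvd initial_form w f" if "g \<in> S" for g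
    using that by blast
  let ?h = "\<lambda>c. [:Const c:] :: ('m, 'k) mpol poly"
  interpret h: unital_ring_hom ?h
    by (rule unital_ring_hom_compose[OF unital_ring_hom_constant_poly unital_ring_hom_Const])
  define p where "p i = \<phi> (Var i)" for i
  have \<phi>: "\<phi> f = eval_mpol ?h p f" for f
    unfolding p_def using assms(3) by (rule alg_hom_eq_eval)
  obtain v :: "'m \<Rightarrow> 'g" where indep: "alg_indep_on UNIV (\<lambda>i. initial_form v (coeff (p i) 0))"
    and w: "\<And>i. wdeg v (coeff (p i) 0) = Fin (w i)"
    using assms(5) by (auto simp: p_def poly_0_coeff_0)
  have "\<exists>i. p i \<notin> z_free"
    using assms(4) z_free_eval_mpol[of _ p Const] by (auto simp: \<phi>)
  with w obtain n u q k where "0 < n"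
    and lead: "\<And>i. additive_weight.leading_part (\<lambda>j a. n \<cdot> wt v a + j \<cdot> u) (n \<cdot> w i) (p i) (q i)"
    and q0: "\<And>i. coeff (q i) 0 = initial_form v (coeff (p i) 0)" and qk: "q k \<notin> z_free"
    by (rule critical_weight) blast
  interpret additive_weight "\<lambda>j a. n \<cdot> wt v a + j \<cdot> u"
    by unfold_locales (simp add: wt_add nat_mult_add_left nat_mult_add_right add_ac)
  define \<psi> where "\<psi> = eval_mpol ?h q"
  interpret \<psi>: unital_ring_hom \<psi>
    unfolding \<psi>_def by (rule h.unital_ring_hom_eval_mpol)
  have inj: "f = 0" if "\<psi> f = 0" for f
    using eval_algebraically_independent_constant_terms[of q f] indep that by (simp add: q0 \<psi>_def)
  have \<psi>_Const: "\<psi> (Const c) = ?h c" for c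
    using h.eval_mpol_single[of q 0 c] by (simp add: \<psi>_def Const_def)
  have \<psi>_Var: "\<psi> (Var i) = q i" for i
    using h.eval_mpol_single[of q "Poly_Mapping.single i 1" 1]
    by (simp add: \<psi>_def Var_def monomial_value_def h.one)
  \<comment> \<open>As \<open>\<phi> f\<close> is free of \<open>z\<close>, so is its leading part \<open>\<psi> (initial_form w f)\<close>, and so are the factors of the latter.\<close>
  have S: "\<psi> g \<in> z_free" if "g \<in> S" for g
  proof -
    obtain f where f: "\<phi> f \<in> z_free" "f \<noteq> 0" "g dvd initial_form w f"
      using divides \<open>g \<in> S\<close> by blast
    obtain d where d: "wdeg w f = Fin d"
      using f(2) by (simp add: wdeg_def)
    have L: "leading_part (n \<cdot> d) (\<phi> f) (\<psi> (initial_form w f))"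
      unfolding \<phi> \<psi>_def using lead \<open>0 < n\<close> d by (rule leading_part_eval)
    have "coeff (\<psi> (initial_form w f)) j = 0" if "0 < j" for j
      by (rule leading_part_coeff_eq_0[OF L]) (use f(1) that in \<open>simp add: z_free_iff coeff_eq_0\<close>)
    then have "degree (\<psi> (initial_form w f)) \<le> 0"
      by (intro degree_le) simp
    then have free: "\<psi> (initial_form w f) \<in> z_free"
      by (simp add: z_free_iff)
    obtain a where "a \<in> Poly_Mapping.keys f" "wt w a = d"
      using wdeg_FinD(3)[OF d] by blast
    then have "Poly_Mapping.lookup (initial_form w f) a \<noteq> 0"
      using d by (simp add: lookup_initial_form in_keys_iff)
    then have "initial_form w f \<noteq> 0"
      by auto
    then have nz: "\<psi> (initial_form w f) \<noteq> 0"
      using inj by blast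
    obtain g' where "initial_form w f = g * g'"
      using f(3) by (rule dvdE)
    then show ?thesis
      using free nz z_free_factor[of "\<psi> g" "\<psi> g'"] by (simp add: \<psi>.mult)
  qed
  have "generated_subalgebra S \<subseteq> {f. \<psi> f \<in> z_free}"
    unfolding generated_subalgebra_def
  proof (rule hull_minimal)
    show "subalgebra {f. \<psi> f \<in> z_free}"
      by (auto simp: subalgebra_def \<psi>_Const \<psi>.add \<psi>.mult z_free_add z_free_mult)
        (auto simp: z_free_def)
  qed (use S in blast)
  moreover obtain B where B: "B \<subseteq> generated_subalgebra S" "finite B" "alg_indep_on B (\<lambda>b. b)"
    "CARD('n) \<le> card B"
    using assms(2,7) by (elim trans_deg_attained) simp_all
  ultimately have \<psi>_B: "\<psi> b \<in> z_free" if "b \<in> B" for b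
    using that by blast
  obtain N F where F: "\<And>l. l < N \<Longrightarrow> vars (F l) \<subseteq> B" "\<exists>l<N. F l \<noteq> 0"
    and rel: "(\<Sum>l<N. subst_mpol (\<lambda>b. b) (F l) * Var k ^ l) = 0"
    by (rule algebraic_dependence[OF B(2,4), of "\<lambda>b. b" "Var k"]) blast
  have "\<psi> (subst_mpol (\<lambda>b. b) (F l)) = 0" if "l < N" for l
  proof (rule z_free_coefficients_vanish)
    show "\<psi> (subst_mpol (\<lambda>b. b) (F l)) \<in> z_free" if "l < N" for l
      using z_free_eval_mpol[of "F l" \<psi> Const] F(1)[OF that] \<psi>_B
      by (auto simp: subst_mpol_eq_eval \<psi>.hom_eval_mpol \<psi>_Const)
    show "(\<Sum>l<N. \<psi> (subst_mpol (\<lambda>b. b) (F l)) * q k ^ l) = 0"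
      using arg_cong[OF rel, of \<psi>] by (simp add: \<psi>.sum \<psi>.mult \<psi>.power \<psi>.zero \<psi>_Var)
  qed fact+
  then have "F l = 0" if "l < N" for l
    using that F(1)[OF that] inj B(3) unfolding alg_indep_on_def by blast
  then show False
    using F(2) by blast
qed

end
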